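(* Let $k\ge 2$ and let $I=(I_1,\dots,I_{2k})$ be a coloring, i.e. a sequence over $\{1,\dots,k\}$ in which each letter appears exactly twice. If $I$ is decomposable, i.e. there is an integer $g$ with $0<g<k$ such that $\{I_1,\dots,I_{2g}\}=\{1,\dots,g\}$ with each of these letters appearing twice among $I_1,\dots,I_{2g}$, then $c(I)=0$, where $c(I)$ is the coloring coefficient of $I$.
   Context: Coloring coefficient. The wall edges are $(1,2),(3,4),\dots,(2k-1,2k)$. A perfect matching $M$ of $\{1,\dots,2k\}$ is connected if the union of the wall edges and the edges of $M$ forms a single Hamiltonian cycle. Writing the edges of $M$ as $(i_1,j_1),\dots,(i_k,j_k)$ with $i_r<j_r$ and $i_1<\cdots<i_k$, $\operatorname{sgn}(M)$ is the sign of the permutation $(i_1,j_1,\dots,i_k,j_k)$ of $\{1,\dots,2k\}$. A lift of a coloring $I$ is a permutation $\sigma\in S_{2k}$ such that $\{\sigma(2w-1),\sigma(2w)\}$ is the set of the two positions of color $w$ in $I$, for every $w\in\{1,\dots,k\}$. A lift $\sigma$ is compatible with $M$ if $\sigma(i)>\sigma(j)$ for every edge $\{i,j\}\in M$ with $i<j$. The lift sign is $\epsilon(\sigma)=\prod_{w=1}^k(-1)^{[\sigma(2w-1)>\sigma(2w)]}$, where $[\cdot]$ is $1$ if the condition holds and $0$ otherwise. Then $$c(I)=(-1)^k\sum_{M\text{ connected}}\operatorname{sgn}(M)\sum_{\substack{\sigma\text{ lift of }I\\ \text{compatible with }M}}\epsilon(\sigma).$$ *)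

theory Defs
  imports Main "HOL-Combinatorics.Permutations"
begin

text \<open>Edges are two-element sets of positions; positions are the natural numbers
  \<open>1, \<dots>, 2 * k\<close>.\<close>

definition wall_edges :: "nat \<Rightarrow> nat set set" where
  "wall_edges k = (\<lambda>w. {2 * w - 1, 2 * w}) ` {1..k}"

definition perfect_matching :: "nat \<Rightarrow> nat set set \<Rightarrow> bool" where
  "perfect_matching k M \<longleftrightarrow>
     (\<forall>e\<in>M. e \<subseteq> {1..2 * k} \<and> card e = 2) \<and> (\<forall>v\<in>{1..2 * k}. \<exists>!e. e \<in> M \<and> v \<in> e)"

text \<open>\<open>E\<close> is the edge set of a cycle through all vertices of \<open>V\<close>. For \<open>card V = 2\<close> this
  accepts the degenerate cycle consisting of a doubled edge. For \<open>card V \<ge> 3\<close> it forces \<open>E\<close> to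
  have \<open>card V\<close> distinct elements, so a matching sharing an edge with the wall edges is not
  connected in the sense below once \<open>k \<ge> 2\<close>.\<close>

definition hamiltonian_cycle :: "'a set \<Rightarrow> 'a set set \<Rightarrow> bool" where
  "hamiltonian_cycle V E \<longleftrightarrow>
     (\<exists>vs. distinct vs \<and> set vs = V \<and>
        E = (\<lambda>i. {vs ! i, vs ! (Suc i mod length vs)}) ` {..<length vs})"

definition connected_matching :: "nat \<Rightarrow> nat set set \<Rightarrow> bool" where
  "connected_matching k M \<longleftrightarrow>
     perfect_matching k M \<and> hamiltonian_cycle {1..2 * k} (wall_edges k \<union> M)"

text \<open>The list \<open>[i\<^sub>1, j\<^sub>1, \<dots>, i\<^sub>k, j\<^sub>k]\<close> for the edges \<open>{i\<^sub>r, j\<^sub>r}\<close> of \<open>M\<close>, where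
  \<open>i\<^sub>r < j\<^sub>r\<close> and \<open>i\<^sub>1 < \<dots> < i\<^sub>k\<close>.\<close>

definition matching_word :: "nat set set \<Rightarrow> nat list" where
  "matching_word M =
     concat (map (\<lambda>i. [i, THE j. {i, j} \<in> M]) (sorted_list_of_set (Min ` M)))"

text \<open>The permutation of \<open>{1..2 * k}\<close> with that one-line notation, extended by the identity
  so that the library's \<^const>\<open>sign\<close> applies.\<close>

definition matching_perm :: "nat \<Rightarrow> nat set set \<Rightarrow> nat \<Rightarrow> nat" where
  "matching_perm k M p = (if p \<in> {1..2 * k} then matching_word M ! (p - 1) else p)"

definition matching_sign :: "nat \<Rightarrow> nat set set \<Rightarrow> int" where
  "matching_sign k M = sign (matching_perm k M)"

text \<open>A coloring \<open>(I\<^sub>1, \<dots>, I\<^sub>2\<^sub>k)\<close> is represented by a function on \<open>nat\<close>, of which only the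
  values on \<open>{1..2 * k}\<close> matter.\<close>

definition coloring :: "nat \<Rightarrow> (nat \<Rightarrow> nat) \<Rightarrow> bool" where
  "coloring k I \<longleftrightarrow>
     (\<forall>p\<in>{1..2 * k}. I p \<in> {1..k}) \<and> (\<forall>w\<in>{1..k}. card {p \<in> {1..2 * k}. I p = w} = 2)"

definition decomposable :: "nat \<Rightarrow> (nat \<Rightarrow> nat) \<Rightarrow> bool" where
  "decomposable k I \<longleftrightarrow>
     (\<exists>g. 0 < g \<and> g < k \<and> I ` {1..2 * g} = {1..g} \<and>
        (\<forall>w\<in>{1..g}. card {p \<in> {1..2 * g}. I p = w} = 2))"

definition lift :: "nat \<Rightarrow> (nat \<Rightarrow> nat) \<Rightarrow> (nat \<Rightarrow> nat) \<Rightarrow> bool" where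
  "lift k I \<sigma> \<longleftrightarrow>
     \<sigma> permutes {1..2 * k} \<and>
     (\<forall>w\<in>{1..k}. {\<sigma> (2 * w - 1), \<sigma> (2 * w)} = {p \<in> {1..2 * k}. I p = w})"

definition compatible :: "nat set set \<Rightarrow> (nat \<Rightarrow> nat) \<Rightarrow> bool" where
  "compatible M \<sigma> \<longleftrightarrow> (\<forall>i j. {i, j} \<in> M \<longrightarrow> i < j \<longrightarrow> \<sigma> i > \<sigma> j)"

definition lift_sign :: "nat \<Rightarrow> (nat \<Rightarrow> nat) \<Rightarrow> int" where
  "lift_sign k \<sigma> = (\<Prod>w\<in>{1..k}. (-1) ^ of_bool (\<sigma> (2 * w - 1) > \<sigma> (2 * w)))"

definition coloring_coefficient :: "nat \<Rightarrow> (nat \<Rightarrow> nat) \<Rightarrow> int" where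
  "coloring_coefficient k I =
     (-1) ^ k *
     (\<Sum>M | connected_matching k M.
        matching_sign k M * (\<Sum>\<sigma> | lift k I \<sigma> \<and> compatible M \<sigma>. lift_sign k \<sigma>))"

end

theory Submission
  imports Defs
begin

text \<open>Every summand of the coefficient vanishes, because a connected matching has no compatible
  lift at all. Let \<open>g\<close> witness the decomposition. A lift sends the positions
  \<open>2 * w - 1\<close> and \<open>2 * w\<close> to the two places of the color \<open>w\<close>, and the colors up to \<open>g\<close> occupy
  exactly the places up to \<open>2 * g\<close>; hence a lift preserves both blocks \<open>{1..2 * g}\<close> and
  \<open>{2 * g + 1..2 * k}\<close> (lemma \<open>lift_le_iff\<close>). The wall edges stay inside the blocks, so the
  Hamiltonian cycle can pass from one block to the other only along an edge \<open>{i, j}\<close> of the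
  matching with \<open>i \<le> 2 * g < j\<close> (lemma \<open>connected_matching_crossing_edge\<close>). On this edge every
  lift satisfies \<open>\<sigma> i \<le> 2 * g < \<sigma> j\<close>, while compatibility demands \<open>\<sigma> i > \<sigma> j\<close>.\<close>

text \<open>Going once around the cycle, membership in \<open>A\<close> would otherwise never change.\<close>

lemma hamiltonian_cycle_crossing_edge:
  assumes "hamiltonian_cycle V E" and "a \<in> V" "a \<in> A" and "b \<in> V" "b \<notin> A"
  obtains x y where "{x, y} \<in> E" "x \<in> A" "y \<notin> A"
proof -
  obtain vs where vs: "set vs = V"
    and E: "E = (\<lambda>i. {vs ! i, vs ! (Suc i mod length vs)}) ` {..<length vs}"
    using assms(1) by (auto simp: hamiltonian_cycle_def)
  have "\<exists>x y. {x, y} \<in> E \<and> x \<in> A \<and> y \<notin> A"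
  proof (rule ccontr)
    assume no_crossing: "\<not> ?thesis"
    have const: "vs ! n \<in> A \<longleftrightarrow> vs ! 0 \<in> A" if "n < length vs" for n
      using that
    proof (induction n)
      case 0
      show ?case by simp
    next
      case (Suc n)
      from Suc.prems have "{vs ! n, vs ! Suc n} \<in> E"
        unfolding E by (intro image_eqI[where x = n]) auto
      with no_crossing have "vs ! n \<in> A \<longleftrightarrow> vs ! Suc n \<in> A"
        by (metis insert_commute)
      with Suc show ?case by simp
    qed
    from assms vs obtain m n where "m < length vs" "vs ! m = a" "n < length vs" "vs ! n = b"
      by (metis in_set_conv_nth)
    with const assms show False by blast
  qed
  with that show thesis by blast
qed

lemma wall_edge_same_side:
  assumes "{x, y} \<in> wall_edges k"
  shows "x \<le> 2 * g \<longleftrightarrow> y \<le> 2 * g"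
  using assms by (auto simp: wall_edges_def doubleton_eq_iff)

lemma connected_matching_crossing_edge:
  assumes "connected_matching k M" and "0 < g" "g < k"
  obtains i j where "{i, j} \<in> M" "i \<le> 2 * g" "2 * g < j"
proof -
  have "hamiltonian_cycle {1..2 * k} (wall_edges k \<union> M)"
    using assms(1) by (simp add: connected_matching_def)
  then obtain i j where "{i, j} \<in> wall_edges k \<union> M" "i \<in> {..2 * g}" "j \<notin> {..2 * g}"
    using assms(2,3)
    by (elim hamiltonian_cycle_crossing_edge[where a = 1 and b = "2 * k" and A = "{..2 * g}"]) auto
  with wall_edge_same_side[of i j k g] that show thesis by auto
qed

lemma lift_color:
  assumes "lift k I \<sigma>" and "p \<in> {1..2 * k}"
  shows "\<sigma> p \<in> {1..2 * k}" and "I (\<sigma> p) = (p + 1) div 2"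
proof -
  define w where "w = (p + 1) div 2"
  have "w \<in> {1..k}" and "p = 2 * w - 1 \<or> p = 2 * w"
    using assms(2) unfolding w_def by (simp, presburger+)
  with assms(1) have "\<sigma> p \<in> {q \<in> {1..2 * k}. I q = w}"
    unfolding lift_def by blast
  then show "\<sigma> p \<in> {1..2 * k}" and "I (\<sigma> p) = (p + 1) div 2"
    by (simp_all add: w_def)
qed

text \<open>A color up to \<open>g\<close> already uses up both its places among the first \<open>2 * g\<close>, so it
  cannot occur later.\<close>

lemma decomposition_color_le_iff:
  assumes "coloring k I" and "g < k" and "I ` {1..2 * g} = {1..g}"
    and "\<forall>w\<in>{1..g}. card {p \<in> {1..2 * g}. I p = w} = 2"
    and p: "p \<in> {1..2 * k}"
  shows "I p \<le> g \<longleftrightarrow> p \<le> 2 * g"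
proof
  assume "I p \<le> g"
  with assms(1) p have w: "I p \<in> {1..g}" by (auto simp: coloring_def)
  have "{q \<in> {1..2 * g}. I q = I p} = {q \<in> {1..2 * k}. I q = I p}"
  proof (rule card_subset_eq)
    show "card {q \<in> {1..2 * g}. I q = I p} = card {q \<in> {1..2 * k}. I q = I p}"
      using assms w by (simp add: coloring_def)
  qed (use \<open>g < k\<close> in auto)
  with p show "p \<le> 2 * g" by fastforce
next
  assume "p \<le> 2 * g"
  with p have "I p \<in> I ` {1..2 * g}" by simp
  with assms(3) show "I p \<le> g" by simp
qed

lemma lift_le_iff:
  assumes "coloring k I" and "g < k" and "I ` {1..2 * g} = {1..g}"
    and "\<forall>w\<in>{1..g}. card {p \<in> {1..2 * g}. I p = w} = 2"
    and "lift k I \<sigma>" and "p \<in> {1..2 * k}"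
  shows "\<sigma> p \<le> 2 * g \<longleftrightarrow> p \<le> 2 * g"
proof -
  have "\<sigma> p \<le> 2 * g \<longleftrightarrow> (p + 1) div 2 \<le> g"
    using decomposition_color_le_iff[OF assms(1-4)] lift_color[OF assms(5,6)] by metis
  then show ?thesis by presburger
qed

theorem theorem3p6:
  fixes k :: nat and I :: "nat \<Rightarrow> nat"
  assumes "k \<ge> 2"
    and "coloring k I"
    and "decomposable k I"
  shows "coloring_coefficient k I = 0"
proof -
  obtain g where g: "0 < g" "g < k" "I ` {1..2 * g} = {1..g}"
    "\<forall>w\<in>{1..g}. card {p \<in> {1..2 * g}. I p = w} = 2"
    using assms(3) unfolding decomposable_def by blast
  have no_lift: "\<not> compatible M \<sigma>" if M: "connected_matching k M" and \<sigma>: "lift k I \<sigma>" for M \<sigma>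
  proof
    assume "compatible M \<sigma>"
    obtain i j where ij: "{i, j} \<in> M" "i \<le> 2 * g" "2 * g < j"
      using connected_matching_crossing_edge[OF M g(1,2)] .
    have "{i, j} \<subseteq> {1..2 * k}"
      using M ij(1) unfolding connected_matching_def perfect_matching_def by blast
    then have "\<sigma> i \<le> 2 * g" and "2 * g < \<sigma> j"
      using lift_le_iff[OF assms(2) g(2-4) \<sigma>, of i] lift_le_iff[OF assms(2) g(2-4) \<sigma>, of j] ij
      by auto
    moreover have "\<sigma> i > \<sigma> j"
      using \<open>compatible M \<sigma>\<close> ij unfolding compatible_def by simp
    ultimately show False by simp
  qed
  have "{\<sigma>. lift k I \<sigma> \<and> compatible M \<sigma>} = {}" if "connected_matching k M" for M
    using no_lift[OF that] by blast
  then show ?thesis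
    unfolding coloring_coefficient_def by (simp del: Collect_empty_eq)
qed

end
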